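(* Let $X$ be a non-compact Tychonoff space. The following are equivalent: (i) $X\models\mathsf S_{\mathrm{fin}}(\mathcal K,\mathcal K^{\mathrm{gp}})$. (ii) One does not have a winning strategy in $\mathsf G_{\mathrm{fin}}(\mathcal K_X,\mathcal K_X^{\mathrm{gp}})$. (iii) $C_k(X)$ is Reznichenko and has countable fan-tightness. (iv) $C_k(X)\models\mathsf S_{\mathrm{fin}}(\Omega_{C_k(X),\mathbf 0},\Omega^{\mathrm{gp}}_{C_k(X),\mathbf 0})$.
   Context: Tychonoff spaces are Hausdorff. For a set $Y$, $[Y]^{<\omega}$ is the set of non-empty finite subsets of $Y$ and $[Y]^\omega$ is the set of countably infinite subsets of $Y$. $K(X)$ is the set of non-empty compact subsets of $X$; $\mathscr T_X$ is the set of open $U\subseteq X$ with $U\neq\emptyset$ and $U\neq X$; $\mathcal K_X$ (the $k$-covers) is the set of all $\mathscr U\subseteq\mathscr T_X$ with $\bigcup\mathscr U=X$ such that every $K\in K(X)$ is contained in some $U\in\mathscr U$. $C_k(X)$ is the set of continuous real-valued functions on $X$ with the topology having as a basis the sets $[f;K,\varepsilon]=\{g:\sup\{|f(x)-g(x)|:x\in K\}<\varepsilon\}$ for $f$ continuous, $K\in K(X)$, $\varepsilon>0$. $\mathbf 0$ is the constant zero function. For a class $\mathfrak C$, $\mathscr C\in\mathfrak C$ is groupable if there is $\phi:\mathscr C\to\omega$ with every $\phi^{-1}(n)$ finite and with $\bigcup\{\phi^{-1}(n):n\in J\}\in\mathfrak C$ for every infinite $J\subseteq\omega$; $\mathfrak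 C^{\mathrm{gp}}$ is the set of groupable members of $\mathfrak C$. $\mathsf S_{\mathrm{fin}}(\mathcal A,\mathcal B)$: for every sequence $\langle\mathscr U_n:n\in\omega\rangle$ in $\mathcal A$ there are $\mathscr F_n\in[\mathscr U_n]^{<\omega}$ with $\bigcup_n\mathscr F_n\in\mathcal B$. $X\models\mathsf S_{\mathrm{fin}}(\mathcal K,\mathcal K^{\mathrm{gp}})$ means $\mathsf S_{\mathrm{fin}}(\mathcal K_X,\mathcal K_X^{\mathrm{gp}})$ holds; $Z\models\mathsf S_{\mathrm{fin}}(\mathcal A,\mathcal B)$ for specific collections means the principle holds for these collections. In the game $\mathsf G_{\mathrm{fin}}(\mathcal A,\mathcal B)$, in inning $n\in\omega$ One plays $A_n\in\mathcal A$ and Two responds with $\mathscr F_n\in[A_n]^{<\omega}$; Two wins if $\bigcup_n\mathscr F_n\in\mathcal B$, otherwise One wins. A strategy for One is a function $\sigma$ from finite sequences of Two's moves to $\mathcal A$; it is winning if for every sequence with $\mathscr F_n\in[\sigma(\langle\mathscr F_k:k<n\rangle)]^{<\omega}$ for all $n$, $\bigcup_n\mathscr F_n\notin\mathcal B$. For a space $Z$ and $z\in Z$, $\Omega_{Z,z}=\{A\subseteq Z: z\in\mathrm{cl}(A)\setminus A\}$. $Z$ has countable fan-tightness if $\mathsf S_{\mathrm{fin}}(\Omega_{Z,z},\Omega_{Z,z})$ holds for every $z\in Z$. $Z$ is Reznichenko if $\Omega_{Z,z}\cap[Z]^\omega=\Omega_{Z,z}^{\mathrm{gp}}$ for every $z\in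 Z$. *)

theory Defs
  imports "HOL-Analysis.Analysis"
begin

subsection \<open>Collections of sets, selection principle and game\<close>

definition fin_subsets :: "'b set \<Rightarrow> 'b set set" where
  "fin_subsets Y = {F. F \<subseteq> Y \<and> finite F \<and> F \<noteq> {}}"

definition ctbl_inf_subsets :: "'b set \<Rightarrow> 'b set set" where
  "ctbl_inf_subsets Y = {A. A \<subseteq> Y \<and> countable A \<and> infinite A}"

definition groupable :: "'b set set \<Rightarrow> 'b set \<Rightarrow> bool" where
  "groupable \<CC> C \<longleftrightarrow>
     (\<exists>\<phi> :: 'b \<Rightarrow> nat. (\<forall>n. finite {c \<in> C. \<phi> c = n}) \<and>
        (\<forall>J. infinite J \<longrightarrow> (\<Union>n\<in>J. {c \<in> C. \<phi> c = n}) \<in> \<CC>))"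

definition gp :: "'b set set \<Rightarrow> 'b set set" where
  "gp \<CC> = {C \<in> \<CC>. groupable \<CC> C}"

definition S_fin :: "'b set set \<Rightarrow> 'b set set \<Rightarrow> bool" where
  "S_fin \<A> \<B> \<longleftrightarrow>
     (\<forall>U :: nat \<Rightarrow> 'b set. (\<forall>n. U n \<in> \<A>) \<longrightarrow>
        (\<exists>F. (\<forall>n. F n \<in> fin_subsets (U n)) \<and> (\<Union>n. F n) \<in> \<B>))"

text \<open>A strategy only matters on lists whose entries are moves available to Two,
  i.e. nonempty finite subsets of members of \<open>\<A>\<close>.\<close>

definition G_fin_strategy_One :: "'b set set \<Rightarrow> ('b set list \<Rightarrow> 'b set) \<Rightarrow> bool" where
  "G_fin_strategy_One \<A> \<sigma> \<longleftrightarrow> (\<forall>s \<in> lists (\<Union>A\<in>\<A>. fin_subsets A). \<sigma> s \<in> \<A>)"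

definition G_fin_winning_One ::
    "'b set set \<Rightarrow> 'b set set \<Rightarrow> ('b set list \<Rightarrow> 'b set) \<Rightarrow> bool" where
  "G_fin_winning_One \<A> \<B> \<sigma> \<longleftrightarrow> G_fin_strategy_One \<A> \<sigma> \<and>
     (\<forall>F :: nat \<Rightarrow> 'b set. (\<forall>n. F n \<in> fin_subsets (\<sigma> (map F [0..<n]))) \<longrightarrow>
        (\<Union>n. F n) \<notin> \<B>)"

subsection \<open>k-covers\<close>

definition compacts :: "'a topology \<Rightarrow> 'a set set" where
  "compacts X = {K. compactin X K \<and> K \<noteq> {}}"

definition proper_opens :: "'a topology \<Rightarrow> 'a set set" where
  "proper_opens X = {U. openin X U \<and> U \<noteq> {} \<and> U \<noteq> topspace X}"

definition k_covers :: "'a topology \<Rightarrow> 'a set set set" where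
  "k_covers X = {\<U>. \<U> \<subseteq> proper_opens X \<and> \<Union>\<U> = topspace X \<and>
     (\<forall>K \<in> compacts X. \<exists>U \<in> \<U>. K \<subseteq> U)}"

subsection \<open>Local properties of a space\<close>

definition Omega_at :: "'b topology \<Rightarrow> 'b \<Rightarrow> 'b set set" where
  "Omega_at Z z = {A. A \<subseteq> topspace Z \<and> z \<in> (Z closure_of A) - A}"

definition countable_fan_tightness :: "'b topology \<Rightarrow> bool" where
  "countable_fan_tightness Z \<longleftrightarrow>
     (\<forall>z \<in> topspace Z. S_fin (Omega_at Z z) (Omega_at Z z))"

definition Reznichenko :: "'b topology \<Rightarrow> bool" where
  "Reznichenko Z \<longleftrightarrow>
     (\<forall>z \<in> topspace Z. Omega_at Z z \<inter> ctbl_inf_subsets (topspace Z) = gp (Omega_at Z z))"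

subsection \<open>The function space with the compact-open topology\<close>

text \<open>Functions are taken to be extensional, so that two functions agreeing on the
  space are equal as points of the function space.\<close>

definition cont_funs :: "'a topology \<Rightarrow> ('a \<Rightarrow> real) set" where
  "cont_funs X = {f \<in> extensional (topspace X). continuous_map X euclideanreal f}"

definition Ck_nbhd :: "'a topology \<Rightarrow> ('a \<Rightarrow> real) \<Rightarrow> 'a set \<Rightarrow> real \<Rightarrow> ('a \<Rightarrow> real) set" where
  "Ck_nbhd X f K \<epsilon> = {g \<in> cont_funs X. (SUP x\<in>K. \<bar>f x - g x\<bar>) < \<epsilon>}"

definition Ck_basis :: "'a topology \<Rightarrow> ('a \<Rightarrow> real) set set" where
  "Ck_basis X = {Ck_nbhd X f K \<epsilon> | f K \<epsilon>. f \<in> cont_funs X \<and> K \<in> compacts X \<and> \<epsilon> > 0}"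

text \<open>The generating sets form a basis, not merely a subbasis: see \<open>Ck_basis_is_base\<close> below.\<close>

definition Ck :: "'a topology \<Rightarrow> ('a \<Rightarrow> real) topology" where
  "Ck X = topology_generated_by (Ck_basis X)"

definition zero_fun :: "'a topology \<Rightarrow> 'a \<Rightarrow> real" where
  "zero_fun X = (\<lambda>x\<in>topspace X. 0)"

lemma zero_fun_in_cont_funs: "zero_fun X \<in> cont_funs X"
proof -
  have "continuous_map X euclideanreal (zero_fun X)"
    by (rule continuous_map_eq[of _ _ "\<lambda>_. 0"]) (auto simp: zero_fun_def)
  then show ?thesis
    by (auto simp: cont_funs_def zero_fun_def)
qed

lemma bdd_above_diff_compact:
  assumes "f \<in> cont_funs X" "g \<in> cont_funs X" "K \<in> compacts X"
  shows "bdd_above ((\<lambda>x. \<bar>f x - g x\<bar>) ` K)"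
proof -
  have "continuous_map X euclideanreal (\<lambda>x. \<bar>f x - g x\<bar>)"
    using assms by (auto simp: cont_funs_def intro!: continuous_intros)
  then have "compactin euclideanreal ((\<lambda>x. \<bar>f x - g x\<bar>) ` K)"
    using assms image_compactin by (fastforce simp: compacts_def)
  then show ?thesis
    by (simp add: bounded_imp_bdd_above compact_imp_bounded)
qed

lemma Ck_nbhd_self:
  assumes "f \<in> cont_funs X" "K \<in> compacts X" "\<epsilon> > 0"
  shows "f \<in> Ck_nbhd X f K \<epsilon>"
  using assms by (auto simp: Ck_nbhd_def compacts_def)

lemma Ck_nbhd_shrink:
  assumes "f \<in> cont_funs X" "K \<in> compacts X" "g \<in> Ck_nbhd X f K \<epsilon>"
  obtains \<delta> where "\<delta> > 0" "Ck_nbhd X g K \<delta> \<subseteq> Ck_nbhd X f K \<epsilon>"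
proof -
  define s where "s = (SUP x\<in>K. \<bar>f x - g x\<bar>)"
  have g: "g \<in> cont_funs X" and s: "s < \<epsilon>"
    using assms by (auto simp: Ck_nbhd_def s_def)
  have "h \<in> Ck_nbhd X f K \<epsilon>" if "h \<in> Ck_nbhd X g K (\<epsilon> - s)" for h
  proof -
    define t where "t = (SUP x\<in>K. \<bar>g x - h x\<bar>)"
    have h: "h \<in> cont_funs X" and t: "t < \<epsilon> - s"
      using that by (auto simp: Ck_nbhd_def t_def)
    have "\<bar>f x - h x\<bar> \<le> s + t" if x: "x \<in> K" for x
    proof -
      have "\<bar>f x - g x\<bar> \<le> s"
        unfolding s_def using x bdd_above_diff_compact[OF assms(1) g assms(2)] by (rule cSUP_upper)
      moreover have "\<bar>g x - h x\<bar> \<le> t"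
        unfolding t_def using x bdd_above_diff_compact[OF g h assms(2)] by (rule cSUP_upper)
      ultimately show ?thesis by linarith
    qed
    then have "(SUP x\<in>K. \<bar>f x - h x\<bar>) \<le> s + t"
      using assms(2) by (intro cSUP_least) (auto simp: compacts_def)
    with h t show ?thesis by (simp add: Ck_nbhd_def)
  qed
  with s show thesis by (intro that[of "\<epsilon> - s"]) auto
qed

lemma Ck_nbhd_mono:
  assumes "f \<in> cont_funs X" "K \<in> compacts X" "L \<in> compacts X" "K \<subseteq> L" "\<delta> \<le> \<epsilon>"
  shows "Ck_nbhd X f L \<delta> \<subseteq> Ck_nbhd X f K \<epsilon>"
proof
  fix g assume g: "g \<in> Ck_nbhd X f L \<delta>"
  then have gc: "g \<in> cont_funs X" by (simp add: Ck_nbhd_def)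
  have "(SUP x\<in>K. \<bar>f x - g x\<bar>) \<le> (SUP x\<in>L. \<bar>f x - g x\<bar>)"
    using assms bdd_above_diff_compact[OF assms(1) gc assms(3)]
    by (intro cSUP_subset_mono) (auto simp: compacts_def)
  with g assms(5) show "g \<in> Ck_nbhd X f K \<epsilon>" by (auto simp: Ck_nbhd_def)
qed

lemma openin_Ck_iff:
  assumes "topspace X \<noteq> {}"
  shows "openin (Ck X) U \<longleftrightarrow> U \<subseteq> cont_funs X \<and>
    (\<forall>f\<in>U. \<exists>K\<in>compacts X. \<exists>\<epsilon>>0. Ck_nbhd X f K \<epsilon> \<subseteq> U)" (is "_ \<longleftrightarrow> ?R U")
proof
  obtain p where p: "p \<in> topspace X" using assms by blast
  then have P: "{p} \<in> compacts X" by (auto simp: compacts_def)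
  assume "openin (Ck X) U"
  then have "generate_topology_on (Ck_basis X) U"
    by (simp add: Ck_def openin_topology_generated_by_iff)
  then show "?R U"
  proof induction
    case Empty
    then show ?case by simp
  next
    case (Int a b)
    show ?case
    proof (intro conjI ballI)
      show "a \<inter> b \<subseteq> cont_funs X" using Int by blast
      fix f assume f: "f \<in> a \<inter> b"
      then obtain K d where K: "K \<in> compacts X" "d > 0" "Ck_nbhd X f K d \<subseteq> a"
        using Int by blast
      obtain L e where L: "L \<in> compacts X" "e > 0" "Ck_nbhd X f L e \<subseteq> b"
        using Int f by blast
      have KL: "K \<union> L \<in> compacts X"
        using K(1) L(1) by (auto simp: compacts_def compactin_Un)
      have fc: "f \<in> cont_funs X" using Int f by blast
      have "Ck_nbhd X f (K \<union> L) (min d e) \<subseteq> a \<inter> b"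
        using Ck_nbhd_mono[OF fc K(1) KL, of "min d e" d] Ck_nbhd_mono[OF fc L(1) KL, of "min d e" e]
          K(3) L(3) by auto
      moreover have "min d e > 0" using K L by simp
      ultimately show "\<exists>K\<in>compacts X. \<exists>\<epsilon>>0. Ck_nbhd X f K \<epsilon> \<subseteq> a \<inter> b"
        using KL by blast
    qed
  next
    case (UN k)
    then show ?case by (meson Sup_le_iff Union_upper UnionE order_trans)
  next
    case (Basis s)
    then obtain f K e where s: "s = Ck_nbhd X f K e" "f \<in> cont_funs X" "K \<in> compacts X"
      by (auto simp: Ck_basis_def)
    show ?case
    proof (intro conjI ballI)
      show "s \<subseteq> cont_funs X" using s by (auto simp: Ck_nbhd_def)
      fix g assume "g \<in> s"
      then obtain d where "d > 0" "Ck_nbhd X g K d \<subseteq> s"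
        using Ck_nbhd_shrink s by metis
      with s show "\<exists>K\<in>compacts X. \<exists>\<epsilon>>0. Ck_nbhd X g K \<epsilon> \<subseteq> s" by blast
    qed
  qed
next
  assume R: "?R U"
  show "openin (Ck X) U"
  proof (subst openin_subopen, intro ballI)
    fix f assume f: "f \<in> U"
    then obtain K e where K: "K \<in> compacts X" "e > 0" "Ck_nbhd X f K e \<subseteq> U" using R by blast
    have fc: "f \<in> cont_funs X" using R f by blast
    have "Ck_nbhd X f K e \<in> Ck_basis X" using fc K by (auto simp: Ck_basis_def)
    then have "openin (Ck X) (Ck_nbhd X f K e)"
      by (simp add: Ck_def topology_generated_by_Basis)
    then show "\<exists>T. openin (Ck X) T \<and> f \<in> T \<and> T \<subseteq> U"
      using K Ck_nbhd_self[OF fc] by blast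
  qed
qed

lemma topspace_Ck:
  assumes "topspace X \<noteq> {}"
  shows "topspace (Ck X) = cont_funs X"
proof
  show "topspace (Ck X) \<subseteq> cont_funs X"
    using openin_Ck_iff[OF assms, THEN iffD1, OF openin_topspace] by (rule conjunct1)
  obtain p where p: "p \<in> topspace X" using assms by blast
  have "openin (Ck X) (cont_funs X)"
  proof (rule openin_Ck_iff[OF assms, THEN iffD2], intro conjI ballI bexI exI)
    show "{p} \<in> compacts X" using p by (simp add: compacts_def)
    show "Ck_nbhd X f {p} 1 \<subseteq> cont_funs X" for f
      unfolding Ck_nbhd_def by (rule Collect_restrict)
  qed simp_all
  then show "cont_funs X \<subseteq> topspace (Ck X)" by (rule openin_subset)
qed

lemma Ck_basis_is_base:
  assumes "topspace X \<noteq> {}"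
  shows "openin (Ck X) = arbitrary union_of (\<lambda>B. B \<in> Ck_basis X)"
proof (rule ext)
  fix U
  show "openin (Ck X) U = (arbitrary union_of (\<lambda>B. B \<in> Ck_basis X)) U"
  proof
    assume "openin (Ck X) U"
    then have R: "U \<subseteq> cont_funs X \<and>
      (\<forall>f\<in>U. \<exists>K\<in>compacts X. \<exists>\<epsilon>>0. Ck_nbhd X f K \<epsilon> \<subseteq> U)"
      by (rule openin_Ck_iff[OF assms, THEN iffD1])
    have "\<exists>B\<in>Ck_basis X. f \<in> B \<and> B \<subseteq> U" if f: "f \<in> U" for f
    proof -
      obtain K e where K: "K \<in> compacts X" "e > 0" "Ck_nbhd X f K e \<subseteq> U"
        using bspec[OF conjunct2[OF R] f] by blast
      have fc: "f \<in> cont_funs X"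
        using conjunct1[OF R] f by (rule subsetD)
      show ?thesis
      proof (intro bexI conjI)
        show "Ck_nbhd X f K e \<in> Ck_basis X"
          using fc K by (auto simp: Ck_basis_def)
      qed (use K Ck_nbhd_self[OF fc] in simp_all)
    qed
    then show "(arbitrary union_of (\<lambda>B. B \<in> Ck_basis X)) U"
      unfolding arbitrary_union_of_alt Bex_def by (rule ballI)
  next
    assume "(arbitrary union_of (\<lambda>B. B \<in> Ck_basis X)) U"
    then obtain \<V> where V: "\<V> \<subseteq> {B. B \<in> Ck_basis X}" "\<Union>\<V> = U"
      unfolding union_of_def arbitrary_def by (elim exE conjE) (rule that, simp_all add: subset_eq)
    have "openin (Ck X) B" if "B \<in> \<V>" for B
      unfolding Ck_def using that V(1) by (intro topology_generated_by_Basis) (simp add: subset_eq)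
    then have "openin (Ck X) (\<Union>\<V>)" by (rule openin_Union)
    with V(2) show "openin (Ck X) U" by simp
  qed
qed

end

theory Submission
  imports Defs
begin

text \<open>
  All four conditions say the same thing: for every sequence of k-covers there are finite
  selections such that each compact set lies in a member of all but finitely many of them
  (the Hurewicz property of k-covers).

  The k-covers of \<open>X\<close>, and the sets accumulating at a point \<open>z\<close> of \<open>C\<^sub>k(X)\<close>, have a common form.
  There is a set \<open>D\<close> of candidates and a set \<open>T\<close> of tests, and a set of candidates counts as a
  cover when every test is passed by one of its members. For k-covers a test is a compact \<open>K\<close>, passed
  by \<open>U\<close> if \<open>K \<subseteq> U\<close>; at \<open>z\<close> a test is a pair \<open>(K, \<epsilon>)\<close>, passed by \<open>f\<close> if \<open>f\<close> is \<open>\<epsilon>\<close>-close to \<open>z\<close>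
  on \<open>K\<close>. In both cases tests are directed, every candidate fails a test, and two candidates passing
  a test have a common refinement passing it (\<open>U \<inter> V\<close>, respectively
  \<open>z + max \<bar>f - z\<bar> \<bar>g - z\<bar>\<close>). The locale \<open>test_family\<close> collects these properties, and from
  them alone follows that eventual selection is equivalent both to the groupable selection
  principle and to One having no winning strategy. The two main points are as follows.

  From groupable selection to eventual selection (\<open>S_fin_imp_eventual_selection\<close>): select from
  the covers by common refinements of the first \<open>n\<close> given covers. Late groups only contain late
  selections, hence refine the cover of any prescribed index.

  From eventual selection to defeating a strategy
  (\<open>eventual_selection_imp_no_winning_strategy\<close>): covers have countable subcovers, so Two needs
  to consider only countably many positions. One application of eventual selection to the covers
  of all these positions gives a reply at each of them, and a test is missed by finitely many
  replies only. The play in which Two follows these replies therefore passes each test from some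
  inning on. If at each position the sets already chosen are removed, which leaves a cover because
  candidates fail some test, the innings themselves are the groups.

  Eventual selection passes from k-covers to \<open>C\<^sub>k(X)\<close> through the sets where \<open>\<bar>f - z\<bar> < 1/(n+1)\<close>, and
  back through functions equal to \<open>1\<close> off a member of the cover, of which there are enough by
  complete regularity. The passage to \<open>C\<^sub>k(X)\<close> works at every \<open>z\<close>, and the groupable principle at
  all points yields countable fan-tightness and the Reznichenko property. Conversely, the union of
  the selections that fan-tightness provides at \<open>\<zero>\<close> is countably infinite, so the Reznichenko
  property makes it groupable.
\<close>

section \<open>Families that meet every test\<close>

definition test_covers :: "'b set \<Rightarrow> 't set \<Rightarrow> ('b \<Rightarrow> 't \<Rightarrow> bool) \<Rightarrow> 'b set set" where
  "test_covers D T p = {A. A \<subseteq> D \<and> (\<forall>t\<in>T. \<exists>a\<in>A. p a t)}"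

definition eventual_selection :: "'b set \<Rightarrow> 't set \<Rightarrow> ('b \<Rightarrow> 't \<Rightarrow> bool) \<Rightarrow> bool" where
  "eventual_selection D T p \<longleftrightarrow>
     (\<forall>A :: nat \<Rightarrow> 'b set. (\<forall>n. A n \<in> test_covers D T p) \<longrightarrow>
        (\<exists>V. (\<forall>n. V n \<in> fin_subsets (A n)) \<and>
             (\<forall>t\<in>T. \<forall>\<^sub>F n in sequentially. \<exists>a\<in>V n. p a t)))"

lemma eventual_selectionD:
  assumes "eventual_selection D T p" and "\<And>n::nat. A n \<in> test_covers D T p"
  shows "\<exists>V. (\<forall>n. V n \<in> fin_subsets (A n)) \<and>
    (\<forall>t\<in>T. \<forall>\<^sub>F n in sequentially. \<exists>a\<in>V n. p a t)"
  using assms unfolding eventual_selection_def by simp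

text \<open>\<open>R n a b\<close> says that \<open>b\<close> certifies \<open>a\<close> at stage \<open>n\<close>: once a selection of certificates has
  been made, the certified members form a selection from the original covers. The certificates may
  become accurate only as \<open>n\<close> grows, as with functions and the bounds \<open>1/(n+1)\<close>.\<close>

lemma eventual_selection_transfer:
  fixes R :: "nat \<Rightarrow> 'b \<Rightarrow> 'c \<Rightarrow> bool"
  assumes sel: "eventual_selection D' T' p'"
    and cov: "\<And>A n. A \<in> test_covers D T p \<Longrightarrow> {b \<in> D'. \<exists>a\<in>A. R n a b} \<in> test_covers D' T' p'"
    and test: "\<And>t. t \<in> T \<Longrightarrow>
      \<exists>s\<in>T'. \<forall>\<^sub>F n in sequentially. \<forall>a\<in>D. \<forall>b\<in>D'. R n a b \<longrightarrow> p' b s \<longrightarrow> p a t"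
  shows "eventual_selection D T p"
  unfolding eventual_selection_def
proof (intro allI impI)
  fix A :: "nat \<Rightarrow> 'b set" assume "\<forall>n. A n \<in> test_covers D T p"
  then have A: "\<And>n. A n \<in> test_covers D T p" by blast
  obtain V where V: "\<And>n. V n \<in> fin_subsets {b \<in> D'. \<exists>a\<in>A n. R n a b}"
    and Vt: "\<And>s. s \<in> T' \<Longrightarrow> \<forall>\<^sub>F n in sequentially. \<exists>b\<in>V n. p' b s"
    using eventual_selectionD[where A = "\<lambda>n. {b \<in> D'. \<exists>a\<in>A n. R n a b}", OF sel cov[OF A]]
    by blast
  have "\<forall>n b. \<exists>a. b \<in> V n \<longrightarrow> a \<in> A n \<and> R n a b"
    using V by (fastforce simp: fin_subsets_def)
  then obtain r where r: "\<And>n b. b \<in> V n \<Longrightarrow> r n b \<in> A n \<and> R n (r n b) b" by metis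
  show "\<exists>V. (\<forall>n. V n \<in> fin_subsets (A n)) \<and>
             (\<forall>t\<in>T. \<forall>\<^sub>F n in sequentially. \<exists>a\<in>V n. p a t)"
  proof (intro exI[of _ "\<lambda>n. r n ` V n"] conjI allI ballI)
    show "r n ` V n \<in> fin_subsets (A n)" for n
      using V[of n] r[of _ n] by (auto simp: fin_subsets_def)
    fix t assume "t \<in> T"
    then obtain s where s: "s \<in> T'"
      and ev: "\<forall>\<^sub>F n in sequentially. \<forall>a\<in>D. \<forall>b\<in>D'. R n a b \<longrightarrow> p' b s \<longrightarrow> p a t"
      using test by blast
    show "\<forall>\<^sub>F n in sequentially. \<exists>a\<in>r n ` V n. p a t"
      using Vt[OF s] ev
    proof eventually_elim
      case (elim n)
      then obtain b where b: "b \<in> V n" "p' b s" by blast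
      moreover have "r n b \<in> D" using r[OF b(1)] A[of n] by (auto simp: test_covers_def)
      moreover have "b \<in> D'" using V[of n] b by (auto simp: fin_subsets_def)
      ultimately show ?case using elim r[OF b(1)] by blast
    qed
  qed
qed

locale test_family =
  fixes D :: "'b set" and T :: "'t set" and p :: "'b \<Rightarrow> 't \<Rightarrow> bool"
  assumes tests_nonempty: "T \<noteq> {}"
    and tests_directed: "\<lbrakk>t \<in> T; t' \<in> T\<rbrakk> \<Longrightarrow> \<exists>s\<in>T. \<forall>a\<in>D. p a s \<longrightarrow> p a t \<and> p a t'"
    and fails_some_test: "a \<in> D \<Longrightarrow> \<exists>t\<in>T. \<not> p a t"
    and common_refinement: "\<lbrakk>a \<in> D; b \<in> D; t \<in> T; p a t; p b t\<rbrakk> \<Longrightarrow>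
      \<exists>c\<in>D. p c t \<and> (\<forall>s\<in>T. p c s \<longrightarrow> p a s \<and> p b s)"
begin

abbreviation "Cov \<equiv> test_covers D T p"

lemma Cov_witness:
  assumes "A \<in> Cov" "t \<in> T"
  obtains a where "a \<in> A" "a \<in> D" "p a t"
  using assms unfolding test_covers_def by blast

lemma Cov_nonempty: "A \<in> Cov \<Longrightarrow> A \<noteq> {}"
  using tests_nonempty by (auto simp: test_covers_def)

lemma Cov_superset: "\<lbrakk>A \<in> Cov; A \<subseteq> B; B \<subseteq> D\<rbrakk> \<Longrightarrow> B \<in> Cov"
  by (fastforce simp: test_covers_def)

text \<open>A removed element fails some test; a member passing that test together with the given one
  is a different element.\<close>

lemma Cov_remove_finite:
  assumes "finite E" "A \<in> Cov"
  shows "A - E \<in> Cov"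
  using assms
proof (induction E)
  case empty
  then show ?case by simp
next
  case (insert e E)
  then have AE: "A - E \<in> Cov" by simp
  have "\<exists>a\<in>A - insert e E. p a t" if t: "t \<in> T" for t
  proof (cases "e \<in> D")
    case True
    then obtain t' where t': "t' \<in> T" "\<not> p e t'" using fails_some_test by blast
    obtain s where s: "s \<in> T" "\<forall>a\<in>D. p a s \<longrightarrow> p a t \<and> p a t'"
      using tests_directed[OF t t'(1)] by blast
    obtain a where "a \<in> A - E" "a \<in> D" "p a s"
      using AE s(1) by (rule Cov_witness)
    then show ?thesis using s t' by blast
  next
    case False
    then show ?thesis using AE t by (fastforce simp: test_covers_def)
  qed
  then show ?case using AE by (auto simp: test_covers_def)
qed

lemma Cov_infinite: "A \<in> Cov \<Longrightarrow> infinite A"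
  using Cov_remove_finite[of A A] Cov_nonempty[of "A - A"] by auto

text \<open>If infinitely many groups missed a test, the union of just these groups would miss it too.\<close>

lemma gp_Cov_iff:
  "C \<in> gp Cov \<longleftrightarrow> C \<subseteq> D \<and> (\<exists>\<phi> :: 'b \<Rightarrow> nat. (\<forall>n. finite {c \<in> C. \<phi> c = n}) \<and>
     (\<forall>t\<in>T. \<forall>\<^sub>F n in sequentially. \<exists>c\<in>C. \<phi> c = n \<and> p c t))"
    (is "_ \<longleftrightarrow> _ \<and> (\<exists>\<phi>. ?fin \<phi> \<and> ?ev \<phi>)")
proof
  assume C: "C \<in> gp Cov"
  then obtain \<phi> :: "'b \<Rightarrow> nat" where fin: "?fin \<phi>"
    and J: "\<And>J. infinite J \<Longrightarrow> (\<Union>n\<in>J. {c \<in> C. \<phi> c = n}) \<in> Cov"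
    unfolding gp_def groupable_def by auto
  have "?ev \<phi>"
  proof
    fix t assume t: "t \<in> T"
    let ?J = "{n. \<not> (\<exists>c\<in>C. \<phi> c = n \<and> p c t)}"
    have "\<not> (\<exists>c\<in>\<Union>n\<in>?J. {c \<in> C. \<phi> c = n}. p c t)" by blast
    then have "(\<Union>n\<in>?J. {c \<in> C. \<phi> c = n}) \<notin> Cov"
      using t unfolding test_covers_def by blast
    then have "finite ?J" using J by blast
    then show "\<forall>\<^sub>F n in sequentially. \<exists>c\<in>C. \<phi> c = n \<and> p c t"
      by (simp add: eventually_cofinite flip: cofinite_eq_sequentially)
  qed
  with fin C show "C \<subseteq> D \<and> (\<exists>\<phi>. ?fin \<phi> \<and> ?ev \<phi>)"
    by (auto simp: gp_def test_covers_def)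
next
  assume R: "C \<subseteq> D \<and> (\<exists>\<phi>. ?fin \<phi> \<and> ?ev \<phi>)"
  then obtain \<phi> where \<phi>: "?fin \<phi>" "?ev \<phi>" by blast
  have J: "(\<Union>n\<in>J. {c \<in> C. \<phi> c = n}) \<in> Cov" if "infinite J" for J
  proof -
    have "\<exists>c\<in>\<Union>n\<in>J. {c \<in> C. \<phi> c = n}. p c t" if t: "t \<in> T" for t
    proof -
      obtain N where N: "\<And>n. n \<ge> N \<Longrightarrow> \<exists>c\<in>C. \<phi> c = n \<and> p c t"
        using \<phi>(2) t unfolding eventually_sequentially by blast
      obtain n where "n \<in> J" "n \<ge> N"
        using \<open>infinite J\<close> by (meson infinite_nat_iff_unbounded_le)
      then show ?thesis using N by blast
    qed
    then show ?thesis using R by (auto simp: test_covers_def)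
  qed
  moreover have "C \<in> Cov"
    using Cov_superset[OF J[of UNIV]] R by auto
  ultimately show "C \<in> gp Cov"
    using \<phi>(1) by (auto simp: gp_def groupable_def)
qed

text \<open>Countably many further elements can be spread over the groups, one for each group.\<close>

lemma gp_Cov_superset:
  assumes B: "B \<in> gp Cov" and "B \<subseteq> A" "A \<subseteq> D" and cnt: "countable A"
  shows "A \<in> gp Cov"
proof -
  obtain \<phi> :: "'b \<Rightarrow> nat" where fin: "\<And>n. finite {c \<in> B. \<phi> c = n}"
    and ev: "\<And>t. t \<in> T \<Longrightarrow> \<forall>\<^sub>F n in sequentially. \<exists>c\<in>B. \<phi> c = n \<and> p c t"
    using B unfolding gp_Cov_iff by blast
  define \<psi> where "\<psi> c = (if c \<in> B then \<phi> c else to_nat_on A c)" for c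
  have "finite {c \<in> A. \<psi> c = n}" for n
  proof (rule finite_subset)
    show "{c \<in> A. \<psi> c = n} \<subseteq> {c \<in> B. \<phi> c = n} \<union> {from_nat_into A n}"
    proof
      fix c assume c: "c \<in> {c \<in> A. \<psi> c = n}"
      show "c \<in> {c \<in> B. \<phi> c = n} \<union> {from_nat_into A n}"
        using c from_nat_into_to_nat_on[OF cnt, of c] by (cases "c \<in> B") (auto simp: \<psi>_def)
    qed
  qed (use fin in simp)
  moreover have "\<forall>\<^sub>F n in sequentially. \<exists>c\<in>A. \<psi> c = n \<and> p c t" if "t \<in> T" for t
    using ev[OF that] by (rule eventually_mono) (use \<open>B \<subseteq> A\<close> in \<open>auto simp: \<psi>_def\<close>)
  ultimately show ?thesis
    unfolding gp_Cov_iff using \<open>A \<subseteq> D\<close> by blast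
qed

lemma disjoint_Union_in_gp_Cov:
  fixes F :: "nat \<Rightarrow> 'b set"
  assumes F: "\<And>n. F n \<subseteq> D" "\<And>n. finite (F n)"
    and disj: "\<And>m n. m < n \<Longrightarrow> F m \<inter> F n = {}"
    and ev: "\<And>t. t \<in> T \<Longrightarrow> \<forall>\<^sub>F n in sequentially. \<exists>a\<in>F n. p a t"
  shows "(\<Union>n. F n) \<in> gp Cov"
proof -
  define \<phi> where "\<phi> c = (THE n. c \<in> F n)" for c
  have \<phi>: "\<phi> c = n" if "c \<in> F n" for c n
    unfolding \<phi>_def
  proof (rule the_equality)
    show "m = n" if "c \<in> F m" for m
      using disj[of m n] disj[of n m] that \<open>c \<in> F n\<close> by (cases m n rule: linorder_cases) auto
  qed fact
  have "{c \<in> \<Union>n. F n. \<phi> c = n} = F n" for n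
    using \<phi> by auto
  moreover have "\<forall>\<^sub>F n in sequentially. \<exists>c\<in>\<Union>n. F n. \<phi> c = n \<and> p c t" if "t \<in> T" for t
    using ev[OF that] by (rule eventually_mono) (use \<phi> in blast)
  ultimately have "(\<forall>n. finite {c \<in> \<Union>n. F n. \<phi> c = n}) \<and>
      (\<forall>t\<in>T. \<forall>\<^sub>F n in sequentially. \<exists>c\<in>\<Union>n. F n. \<phi> c = n \<and> p c t)"
    using F(2) by simp
  moreover have "(\<Union>n. F n) \<subseteq> D" using F(1) by blast
  ultimately show ?thesis
    unfolding gp_Cov_iff by blast
qed

section \<open>Selection, eventual selection and the game\<close>

text \<open>The groups of a groupable union need not respect the stages at which their elements were
  selected. Selecting from refinements of all earlier covers repairs this: an element selected
  at stage \<open>k\<close> serves every cover of index at most \<open>k\<close>.\<close>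

lemma S_fin_imp_eventual_selection:
  assumes S: "S_fin Cov (gp Cov)"
  shows "eventual_selection D T p"
  unfolding eventual_selection_def
proof (intro allI impI)
  fix A :: "nat \<Rightarrow> 'b set" assume "\<forall>n. A n \<in> Cov"
  then have A: "\<And>n. A n \<in> Cov" by blast
  define W where "W n = {c \<in> D. \<forall>i\<le>n. \<exists>a\<in>A i. \<forall>s\<in>T. p c s \<longrightarrow> p a s}" for n
  have "\<exists>c\<in>W n. p c t" if t: "t \<in> T" for n t
  proof (induction n)
    case 0
    then show ?case using A[of 0] t by (fastforce simp: W_def test_covers_def)
  next
    case (Suc n)
    then obtain c where c: "c \<in> W n" "p c t" by blast
    obtain a where a: "a \<in> A (Suc n)" "a \<in> D" "p a t"
      using A t by (rule Cov_witness)
    obtain d where d: "d \<in> D" "p d t" "\<forall>s\<in>T. p d s \<longrightarrow> p c s \<and> p a s"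
      using common_refinement[of c a t] c a t by (auto simp: W_def)
    have "\<exists>a'\<in>A i. \<forall>s\<in>T. p d s \<longrightarrow> p a' s" if "i \<le> Suc n" for i
    proof (cases "i = Suc n")
      case True
      then show ?thesis using a d by blast
    next
      case False
      then have "i \<le> n" using that by simp
      then obtain a' where "a' \<in> A i" "\<forall>s\<in>T. p c s \<longrightarrow> p a' s"
        using c by (auto simp: W_def)
      then show ?thesis using d by blast
    qed
    then have "d \<in> W (Suc n)" using d by (auto simp: W_def)
    then show ?case using d by blast
  qed
  then have "W n \<in> Cov" for n by (auto simp: test_covers_def W_def)
  then obtain F where F: "\<And>n. F n \<in> fin_subsets (W n)" and C: "(\<Union>n. F n) \<in> gp Cov"
    using S unfolding S_fin_def by meson
  define C where "C = (\<Union>n. F n)"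
  obtain \<phi> :: "'b \<Rightarrow> nat" where fin: "\<And>n. finite {c \<in> C. \<phi> c = n}"
    and ev: "\<And>t. t \<in> T \<Longrightarrow> \<forall>\<^sub>F n in sequentially. \<exists>c\<in>C. \<phi> c = n \<and> p c t"
    using C[folded C_def] unfolding gp_Cov_iff by blast
  \<comment> \<open>Only finitely many groups meet the first \<open>n\<close> selections; a group \<open>m n\<close> beyond them
    consists of refinements of members of \<open>A n\<close>.\<close>
  have "\<exists>m\<ge>n. \<forall>c\<in>C. \<phi> c = m \<longrightarrow> (\<exists>a\<in>A n. \<forall>s\<in>T. p c s \<longrightarrow> p a s)" for n
  proof -
    have "finite (\<phi> ` (\<Union>i<n. F i) \<union> {..<n})"
      using F by (auto simp: fin_subsets_def)
    then obtain m where m: "m \<notin> \<phi> ` (\<Union>i<n. F i) \<union> {..<n}"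
      using ex_new_if_finite[OF infinite_UNIV_nat] by blast
    have "\<exists>a\<in>A n. \<forall>s\<in>T. p c s \<longrightarrow> p a s" if "c \<in> C" "\<phi> c = m" for c
    proof -
      obtain k where k: "c \<in> F k" using \<open>c \<in> C\<close> by (auto simp: C_def)
      then have "n \<le> k" using m that by (meson UN_I UnI1 image_eqI lessThan_iff not_le)
      moreover have "c \<in> W k" using F[of k] k by (auto simp: fin_subsets_def)
      ultimately show ?thesis by (auto simp: W_def)
    qed
    moreover have "n \<le> m" using m by auto
    ultimately show ?thesis by blast
  qed
  then obtain m where m: "\<And>n. n \<le> m n"
    and mC: "\<And>n c. \<lbrakk>c \<in> C; \<phi> c = m n\<rbrakk> \<Longrightarrow> \<exists>a\<in>A n. \<forall>s\<in>T. p c s \<longrightarrow> p a s"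
    by metis
  then have "\<forall>n c. \<exists>a. c \<in> C \<and> \<phi> c = m n \<longrightarrow> a \<in> A n \<and> (\<forall>s\<in>T. p c s \<longrightarrow> p a s)" by blast
  then obtain r where
    r: "\<And>n c. \<lbrakk>c \<in> C; \<phi> c = m n\<rbrakk> \<Longrightarrow> r n c \<in> A n \<and> (\<forall>s\<in>T. p c s \<longrightarrow> p (r n c) s)"
    by metis
  have "\<forall>n. \<exists>a. a \<in> A n" using A Cov_nonempty by blast
  then obtain a0 where a0: "\<And>n. a0 n \<in> A n" by metis
  have m_lim: "filterlim m sequentially sequentially"
    by (rule filterlim_at_top_mono[OF filterlim_ident]) (simp add: m)
  \<comment> \<open>The group \<open>m n\<close> may be empty, whereas selections must not be; hence \<open>a0 n\<close>.\<close>
  let ?V = "\<lambda>n. insert (a0 n) (r n ` {c \<in> C. \<phi> c = m n})"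
  show "\<exists>V. (\<forall>n. V n \<in> fin_subsets (A n)) \<and>
             (\<forall>t\<in>T. \<forall>\<^sub>F n in sequentially. \<exists>a\<in>V n. p a t)"
  proof (intro exI[of _ ?V] conjI allI ballI)
    show "?V n \<in> fin_subsets (A n)" for n
      using fin[of "m n"] a0 r by (auto simp: fin_subsets_def)
    fix t assume t: "t \<in> T"
    show "\<forall>\<^sub>F n in sequentially. \<exists>a\<in>?V n. p a t"
      using eventually_compose_filterlim[OF ev[OF t] m_lim]
      by (rule eventually_mono) (use r t in blast)
  qed
qed

lemma eventual_selection_countable:
  assumes sel: "eventual_selection D T p" and I: "countable I" "I \<noteq> {}"
    and A: "\<And>i. i \<in> I \<Longrightarrow> A i \<in> Cov"
  shows "\<exists>V. (\<forall>i\<in>I. V i \<in> fin_subsets (A i)) \<and>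
    (\<forall>t\<in>T. finite {i \<in> I. \<not> (\<exists>a\<in>V i. p a t)})"
proof -
  have Cov: "A (from_nat_into I n) \<in> Cov" for n
    by (rule A[OF from_nat_into[OF I(2)]])
  obtain V where V: "\<And>n. V n \<in> fin_subsets (A (from_nat_into I n))"
    and Vt: "\<And>t. t \<in> T \<Longrightarrow> \<forall>\<^sub>F n in sequentially. \<exists>a\<in>V n. p a t"
    using eventual_selectionD[where A = "\<lambda>n. A (from_nat_into I n)", OF sel Cov] by blast
  show ?thesis
  proof (intro exI[of _ "\<lambda>i. V (to_nat_on I i)"] conjI ballI)
    show "V (to_nat_on I i) \<in> fin_subsets (A i)" if "i \<in> I" for i
      using V[of "to_nat_on I i"] I that by simp
    fix t assume "t \<in> T"
    then have "finite {n. \<not> (\<exists>a\<in>V n. p a t)}"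
      using Vt by (simp add: eventually_cofinite flip: cofinite_eq_sequentially)
    then have "finite {i \<in> I. to_nat_on I i \<in> {n. \<not> (\<exists>a\<in>V n. p a t)}}"
      using finite_inverse_image_gen[of "{n. \<not> (\<exists>a\<in>V n. p a t)}" "to_nat_on I" I] I
      by (simp add: inj_on_to_nat_on)
    then show "finite {i \<in> I. \<not> (\<exists>a\<in>V (to_nat_on I i). p a t)}" by simp
  qed
qed

lemma countable_subcover:
  assumes sel: "eventual_selection D T p" and A: "A \<in> Cov"
  shows "\<exists>B\<subseteq>A. countable B \<and> B \<in> Cov"
proof -
  obtain V :: "nat \<Rightarrow> 'b set" where V: "\<And>n. V n \<in> fin_subsets A"
    and Vt: "\<And>t. t \<in> T \<Longrightarrow> \<forall>\<^sub>F n in sequentially. \<exists>a\<in>V n. p a t"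
    using eventual_selectionD[where A = "\<lambda>_. A", OF sel A] by blast
  have VA: "(\<Union>n. V n) \<subseteq> A" using V by (auto simp: fin_subsets_def)
  moreover have "countable (\<Union>n. V n)"
    using V by (auto simp: fin_subsets_def intro: countable_finite)
  moreover have "\<exists>a\<in>\<Union>n. V n. p a t" if "t \<in> T" for t
    using eventually_happens[OF Vt[OF that]] by auto
  then have "(\<Union>n. V n) \<in> Cov" using VA A by (auto simp: test_covers_def)
  ultimately show ?thesis by blast
qed

text \<open>Two's replies are prepared for all positions at once, so that a test is missed at finitely many
  positions only; along a single play the positions are pairwise distinct.\<close>

lemma eventual_selection_imp_no_winning_strategy:
  assumes sel: "eventual_selection D T p"
  shows "\<not> G_fin_winning_One Cov (gp Cov) \<sigma>"
proof
  assume win: "G_fin_winning_One Cov (gp Cov) \<sigma>"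
  have "\<forall>A. \<exists>B. A \<in> Cov \<longrightarrow> B \<subseteq> A \<and> countable B \<and> B \<in> Cov"
    using countable_subcover[OF sel] by blast
  then obtain B where B: "\<And>A. A \<in> Cov \<Longrightarrow> B A \<subseteq> A \<and> countable (B A) \<and> B A \<in> Cov"
    by metis
  define L where "L = lists (\<Union>A\<in>Cov. fin_subsets A)"
  have \<sigma>: "\<sigma> s \<in> Cov" if "s \<in> L" for s
    using win that by (auto simp: G_fin_winning_One_def G_fin_strategy_One_def L_def)
  \<comment> \<open>\<open>P n\<close> consists of the positions after \<open>n\<close> innings in which Two has picked from the countable
    subcovers \<open>B\<close> only.\<close>
  define P where "P = rec_nat {[]} (\<lambda>_ Q. \<Union>s\<in>Q. (\<lambda>F. s @ [F]) ` fin_subsets (B (\<sigma> s)))"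
  have P0: "P 0 = {[]}"
    and PS: "\<And>n. P (Suc n) = (\<Union>s\<in>P n. (\<lambda>F. s @ [F]) ` fin_subsets (B (\<sigma> s)))"
    by (simp_all add: P_def)
  have PL: "P n \<subseteq> L \<and> countable (P n)" for n
  proof (induction n)
    case 0
    then show ?case by (simp add: P0 L_def)
  next
    case (Suc n)
    have cf: "countable (fin_subsets (B (\<sigma> s)))" if "s \<in> P n" for s
      by (rule countable_subset[OF _ countable_Collect_finite_subset[of "B (\<sigma> s)"]])
        (use B \<sigma> Suc that in \<open>auto simp: fin_subsets_def\<close>)
    have "s @ [F] \<in> L" if "s \<in> P n" "F \<in> fin_subsets (B (\<sigma> s))" for s F
    proof -
      have "s \<in> L" using that Suc by blast
      moreover have "B (\<sigma> s) \<in> Cov" using B \<sigma> \<open>s \<in> L\<close> by blast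
      ultimately show ?thesis using that(2) by (auto simp: L_def)
    qed
    then show ?case using Suc cf by (auto simp: PS)
  qed
  define I where "I = (\<Union>n. P n)"
  \<comment> \<open>Removing the sets chosen so far keeps the selections of different innings disjoint.\<close>
  define A where "A s = B (\<sigma> s) - \<Union>(set s)" for s
  have I: "countable I" "I \<subseteq> L"
    using PL by (auto simp: I_def)
  have "[] \<in> I" using P0 by (auto simp: I_def)
  then have "I \<noteq> {}" by blast
  have A: "A s \<in> Cov" if "s \<in> I" for s
  proof -
    have sL: "s \<in> L" using I that by blast
    then have "finite (\<Union>(set s))" by (auto simp: L_def fin_subsets_def)
    then show ?thesis
      unfolding A_def using B \<sigma>[OF sL] by (intro Cov_remove_finite) auto
  qed
  obtain V where V: "\<And>s. s \<in> I \<Longrightarrow> V s \<in> fin_subsets (A s)"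
    and Vt: "\<And>t. t \<in> T \<Longrightarrow> finite {s \<in> I. \<not> (\<exists>a\<in>V s. p a t)}"
    using eventual_selection_countable[where A = A, OF sel I(1) \<open>I \<noteq> {}\<close> A] by blast
  \<comment> \<open>\<open>q n\<close> is the position after \<open>n\<close> innings of the play in which Two replies by \<open>V\<close>.\<close>
  define q where "q = rec_nat [] (\<lambda>_ s. s @ [V s])"
  have q0: "q 0 = []" and qS: "\<And>n. q (Suc n) = q n @ [V (q n)]" by (simp_all add: q_def)
  have VB: "V s \<in> fin_subsets (B (\<sigma> s))" if "s \<in> I" for s
    using V[OF that] by (auto simp: fin_subsets_def A_def)
  have qP: "q n \<in> P n" for n
  proof (induction n)
    case (Suc n)
    then have "q n \<in> I" by (auto simp: I_def)
    then show ?case using Suc VB by (auto simp: PS qS)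
  qed (simp add: q0 P0)
  then have qI: "q n \<in> I" for n by (auto simp: I_def)
  define F where "F n = V (q n)" for n
  have qF: "q n = map F [0..<n]" for n
    by (induction n) (simp_all add: q0 qS F_def)
  have FA: "F n \<subseteq> A (q n)" "finite (F n)" for n
    using V[OF qI[of n]] by (auto simp: F_def fin_subsets_def)
  have "inj q"
  proof (rule injI)
    fix m n assume "q m = q n"
    then have "length (map F [0..<m]) = length (map F [0..<n])" by (simp only: qF)
    then show "m = n" by simp
  qed
  have "(\<Union>n. F n) \<in> gp Cov"
  proof (rule disjoint_Union_in_gp_Cov)
    show "F n \<subseteq> D" for n
      using FA(1)[of n] A[OF qI[of n]] by (auto simp: test_covers_def)
    show "F m \<inter> F n = {}" if "m < n" for m n
      using FA(1)[of n] that by (auto simp: A_def qF)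
    fix t assume "t \<in> T"
    then have "finite (q -` {s \<in> I. \<not> (\<exists>a\<in>V s. p a t)})"
      using Vt \<open>inj q\<close> by (intro finite_vimageI) auto
    then show "\<forall>\<^sub>F n in sequentially. \<exists>a\<in>F n. p a t"
      using qI by (simp add: eventually_cofinite F_def flip: cofinite_eq_sequentially)
  qed (use FA in simp)
  moreover have "F n \<in> fin_subsets (\<sigma> (map F [0..<n]))" for n
  proof -
    have "B (\<sigma> (q n)) \<subseteq> \<sigma> (q n)" using B \<sigma> I(2) qI by blast
    then show ?thesis using VB[OF qI[of n]] by (auto simp: fin_subsets_def F_def qF)
  qed
  ultimately show False
    using win unfolding G_fin_winning_One_def by blast
qed

end

text \<open>A sequence witnessing the failure of the selection principle is a winning strategy that
  ignores the moves of Two.\<close>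

lemma no_winning_strategy_imp_S_fin:
  fixes \<A> \<B> :: "'b set set"
  assumes "\<not> (\<exists>\<sigma>. G_fin_winning_One \<A> \<B> \<sigma>)"
  shows "S_fin \<A> \<B>"
  unfolding S_fin_def
proof (intro allI impI)
  fix U :: "nat \<Rightarrow> 'b set" assume U: "\<forall>n. U n \<in> \<A>"
  then have "G_fin_strategy_One \<A> (\<lambda>s. U (length s))"
    by (simp add: G_fin_strategy_One_def)
  then obtain F where "\<forall>n. F n \<in> fin_subsets (U n)" "(\<Union>n. F n) \<in> \<B>"
    using assms unfolding G_fin_winning_One_def by fastforce
  then show "\<exists>F. (\<forall>n. F n \<in> fin_subsets (U n)) \<and> (\<Union>n. F n) \<in> \<B>" by blast
qed

context test_family
begin

lemma no_winning_strategy_iff_eventual_selection: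
  "\<not> (\<exists>\<sigma>. G_fin_winning_One Cov (gp Cov) \<sigma>) \<longleftrightarrow> eventual_selection D T p"
  using eventual_selection_imp_no_winning_strategy no_winning_strategy_imp_S_fin
    S_fin_imp_eventual_selection by blast

lemma S_fin_gp_iff_eventual_selection:
  "S_fin Cov (gp Cov) \<longleftrightarrow> eventual_selection D T p"
  using no_winning_strategy_iff_eventual_selection no_winning_strategy_imp_S_fin
    S_fin_imp_eventual_selection by blast

text \<open>Selecting from the constant sequence \<open>A, A, \<dots>\<close> yields a groupable subset of \<open>A\<close>, and the
  rest of a countable \<open>A\<close> can be added to its groups.\<close>

lemma S_fin_gp_imp_countable_eq_gp:
  assumes S: "S_fin Cov (gp Cov)" and "D \<subseteq> Y"
  shows "Cov \<inter> ctbl_inf_subsets Y = gp Cov"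
proof (intro equalityI subsetI)
  fix A assume "A \<in> Cov \<inter> ctbl_inf_subsets Y"
  then have A: "A \<in> Cov" "countable A" by (auto simp: ctbl_inf_subsets_def)
  then obtain F :: "nat \<Rightarrow> 'b set" where "\<And>n. F n \<in> fin_subsets A" "(\<Union>n. F n) \<in> gp Cov"
    using S[unfolded S_fin_def, rule_format, of "\<lambda>_. A"] by blast
  then show "A \<in> gp Cov"
    using A by (intro gp_Cov_superset[of "\<Union>n. F n" A]) (auto simp: fin_subsets_def test_covers_def)
next
  fix A assume A: "A \<in> gp Cov"
  then obtain \<phi> :: "'b \<Rightarrow> nat" where fin: "\<And>n. finite {c \<in> A. \<phi> c = n}"
    unfolding gp_Cov_iff by blast
  have "countable (\<Union>n. {c \<in> A. \<phi> c = n})"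
    using fin by (intro countable_UN) (auto intro: countable_finite)
  moreover have "(\<Union>n. {c \<in> A. \<phi> c = n}) = A" by blast
  ultimately have "countable A" by simp
  moreover have "A \<in> Cov" using A by (simp add: gp_def)
  ultimately show "A \<in> Cov \<inter> ctbl_inf_subsets Y"
    using Cov_infinite \<open>D \<subseteq> Y\<close> by (auto simp: ctbl_inf_subsets_def test_covers_def)
qed

end

section \<open>The two instances: k-covers and sets accumulating at a function\<close>

lemma compacts_Un: "\<lbrakk>K \<in> compacts X; L \<in> compacts X\<rbrakk> \<Longrightarrow> K \<union> L \<in> compacts X"
  by (auto simp: compacts_def compactin_Un)

lemma singleton_compacts: "x \<in> topspace X \<Longrightarrow> {x} \<in> compacts X"
  by (simp add: compacts_def)

lemma compacts_subset_topspace: "K \<in> compacts X \<Longrightarrow> K \<subseteq> topspace X"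
  by (simp add: compacts_def compactin_subset_topspace)

lemma k_covers_eq_test_covers:
  "k_covers X = test_covers (proper_opens X) (compacts X) (\<lambda>U K. K \<subseteq> U)"
proof -
  have "\<Union>\<U> = topspace X"
    if "\<U> \<subseteq> proper_opens X" and K: "\<forall>K\<in>compacts X. \<exists>U\<in>\<U>. K \<subseteq> U" for \<U>
  proof
    show "\<Union>\<U> \<subseteq> topspace X" using that by (auto simp: proper_opens_def dest: openin_subset)
    show "topspace X \<subseteq> \<Union>\<U>" using K singleton_compacts[of _ X] by blast
  qed
  then show ?thesis by (auto simp: k_covers_def test_covers_def)
qed

lemma test_family_k_covers:
  assumes "topspace X \<noteq> {}"
  shows "test_family (proper_opens X) (compacts X) (\<lambda>U K. K \<subseteq> U)"
proof
  obtain x where "x \<in> topspace X" using assms by blast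
  then show "compacts X \<noteq> {}" using singleton_compacts[of x X] by auto
next
  fix K L assume "K \<in> compacts X" "L \<in> compacts X"
  then have "K \<union> L \<in> compacts X" by (rule compacts_Un)
  then show "\<exists>M\<in>compacts X. \<forall>U\<in>proper_opens X. M \<subseteq> U \<longrightarrow> K \<subseteq> U \<and> L \<subseteq> U"
    by (rule rev_bexI) simp
next
  fix U assume "U \<in> proper_opens X"
  then have "U \<subset> topspace X"
    using openin_subset[of X U] by (auto simp: proper_opens_def)
  then obtain x where "x \<in> topspace X" "x \<notin> U" by blast
  then show "\<exists>K\<in>compacts X. \<not> K \<subseteq> U"
    by (intro bexI[of _ "{x}"]) (simp_all add: singleton_compacts)
next
  fix U V K
  assume "U \<in> proper_opens X" "V \<in> proper_opens X" "K \<in> compacts X" "K \<subseteq> U" "K \<subseteq> V"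
  then have "U \<inter> V \<in> proper_opens X"
    using openin_subset[of X U] by (auto simp: proper_opens_def compacts_def)
  then show "\<exists>W\<in>proper_opens X. K \<subseteq> W \<and> (\<forall>L\<in>compacts X. L \<subseteq> W \<longrightarrow> L \<subseteq> U \<and> L \<subseteq> V)"
    by (rule rev_bexI) (simp add: \<open>K \<subseteq> U\<close> \<open>K \<subseteq> V\<close>)
qed

text \<open>Pointwise closeness replaces the supremum in the basic neighbourhoods; the two differ by at most
  the choice between \<open>\<epsilon>\<close> and \<open>\<epsilon> / 2\<close>, which the closure does not see.\<close>

definition close_on :: "('a \<Rightarrow> real) \<Rightarrow> ('a \<Rightarrow> real) \<Rightarrow> 'a set \<times> real \<Rightarrow> bool" where
  "close_on z f = (\<lambda>(K, \<epsilon>). \<forall>x\<in>K. \<bar>f x - z x\<bar> < \<epsilon>)"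

lemma close_on_iff [simp]: "close_on z f (K, \<epsilon>) \<longleftrightarrow> (\<forall>x\<in>K. \<bar>f x - z x\<bar> < \<epsilon>)"
  by (simp add: close_on_def)

lemma Ck_nbhd_imp_close_on:
  assumes "z \<in> cont_funs X" "K \<in> compacts X" "f \<in> Ck_nbhd X z K \<epsilon>"
  shows "close_on z f (K, \<epsilon>)"
proof -
  have f: "f \<in> cont_funs X" and sup: "(SUP x\<in>K. \<bar>z x - f x\<bar>) < \<epsilon>"
    using assms(3) by (auto simp: Ck_nbhd_def)
  have "\<bar>z x - f x\<bar> < \<epsilon>" if "x \<in> K" for x
    using cSUP_upper[OF that bdd_above_diff_compact[OF assms(1) f assms(2)]] sup by simp
  then show ?thesis by (simp add: abs_minus_commute)
qed

lemma close_on_imp_Ck_nbhd: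
  assumes "f \<in> cont_funs X" "K \<in> compacts X" "close_on z f (K, \<epsilon> / 2)" "\<epsilon> > 0"
  shows "f \<in> Ck_nbhd X z K \<epsilon>"
proof -
  have "(SUP x\<in>K. \<bar>z x - f x\<bar>) \<le> \<epsilon> / 2"
    using assms by (intro cSUP_least) (auto simp: compacts_def abs_minus_commute less_imp_le)
  then show ?thesis using assms by (simp add: Ck_nbhd_def)
qed

lemma in_closure_of_Ck_iff:
  assumes "topspace X \<noteq> {}" "z \<in> cont_funs X" "A \<subseteq> cont_funs X"
  shows "z \<in> Ck X closure_of A \<longleftrightarrow> (\<forall>t\<in>compacts X \<times> {0<..}. \<exists>f\<in>A. close_on z f t)"
proof
  assume z: "z \<in> Ck X closure_of A"
  have "\<exists>f\<in>A. close_on z f (K, \<epsilon>)" if K: "K \<in> compacts X" "\<epsilon> > 0" for K \<epsilon>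
  proof -
    have "Ck_nbhd X z K \<epsilon> \<in> Ck_basis X" using K assms(2) by (auto simp: Ck_basis_def)
    then have "openin (Ck X) (Ck_nbhd X z K \<epsilon>)"
      by (simp add: Ck_def topology_generated_by_Basis)
    then obtain f where "f \<in> A" "f \<in> Ck_nbhd X z K \<epsilon>"
      using z Ck_nbhd_self[OF assms(2) K] by (auto simp: in_closure_of)
    then show ?thesis using Ck_nbhd_imp_close_on[OF assms(2) K(1)] by blast
  qed
  then show "\<forall>t\<in>compacts X \<times> {0<..}. \<exists>f\<in>A. close_on z f t" by auto
next
  assume R: "\<forall>t\<in>compacts X \<times> {0<..}. \<exists>f\<in>A. close_on z f t"
  have "\<exists>f\<in>A. f \<in> U" if U: "z \<in> U" "openin (Ck X) U" for U
  proof -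
    obtain K \<epsilon> where K: "K \<in> compacts X" "\<epsilon> > 0" "Ck_nbhd X z K \<epsilon> \<subseteq> U"
      using U openin_Ck_iff[OF assms(1)] by blast
    then obtain f where "f \<in> A" "close_on z f (K, \<epsilon> / 2)"
      using R[rule_format, of "(K, \<epsilon> / 2)"] by auto
    then show ?thesis using close_on_imp_Ck_nbhd[of f X K z \<epsilon>] K assms(3) by blast
  qed
  then show "z \<in> Ck X closure_of A"
    using assms by (auto simp: in_closure_of topspace_Ck)
qed

lemma Omega_at_eq_test_covers:
  assumes "topspace X \<noteq> {}" "z \<in> cont_funs X"
  shows "Omega_at (Ck X) z = test_covers (cont_funs X - {z}) (compacts X \<times> {0<..}) (close_on z)"
proof -
  have "A \<in> Omega_at (Ck X) z \<longleftrightarrow>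
      A \<in> test_covers (cont_funs X - {z}) (compacts X \<times> {0<..}) (close_on z)" for A
    unfolding Omega_at_def test_covers_def mem_Collect_eq topspace_Ck[OF assms(1)] Diff_iff
    using in_closure_of_Ck_iff[OF assms, of A] by blast
  then show ?thesis by blast
qed

lemma test_family_Omega_at:
  assumes "topspace X \<noteq> {}" and z: "z \<in> cont_funs X"
  shows "test_family (cont_funs X - {z}) (compacts X \<times> {0<..}) (close_on z)"
proof
  obtain x where "x \<in> topspace X" using assms by blast
  then have "({x}, 1) \<in> compacts X \<times> {0::real<..}" using singleton_compacts by simp
  then show "compacts X \<times> {0::real<..} \<noteq> {}" by blast
next
  fix s t assume "s \<in> compacts X \<times> {0::real<..}" "t \<in> compacts X \<times> {0::real<..}"
  then obtain K \<epsilon> L \<delta> where eq: "s = (K, \<epsilon>)" "t = (L, \<delta>)"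
    and *: "K \<in> compacts X" "L \<in> compacts X" "\<epsilon> > 0" "\<delta> > 0" by blast
  show "\<exists>u\<in>compacts X \<times> {0<..}. \<forall>f\<in>cont_funs X - {z}.
      close_on z f u \<longrightarrow> close_on z f s \<and> close_on z f t"
    using * by (intro bexI[of _ "(K \<union> L, min \<epsilon> \<delta>)"]) (auto simp: eq compacts_Un)
next
  fix f assume f: "f \<in> cont_funs X - {z}"
  then obtain x where x: "x \<in> topspace X" "f x \<noteq> z x"
    using z extensionalityI[of f "topspace X" z] by (auto simp: cont_funs_def)
  then show "\<exists>t\<in>compacts X \<times> {0<..}. \<not> close_on z f t"
    by (intro bexI[of _ "({x}, \<bar>f x - z x\<bar>)"]) (auto simp: singleton_compacts)
next
  fix f g and t :: "'a set \<times> real"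
  assume f: "f \<in> cont_funs X - {z}" and g: "g \<in> cont_funs X - {z}"
    and t: "t \<in> compacts X \<times> {0<..}" "close_on z f t" "close_on z g t"
  \<comment> \<open>\<open>h\<close> lies as far from \<open>z\<close> as the farther of \<open>f\<close> and \<open>g\<close>, so it passes exactly the tests
    that both pass.\<close>
  define h where "h = (\<lambda>x\<in>topspace X. z x + max \<bar>f x - z x\<bar> \<bar>g x - z x\<bar>)"
  have "continuous_map X euclideanreal (\<lambda>x. z x + max \<bar>f x - z x\<bar> \<bar>g x - z x\<bar>)"
    using f g z
    by (intro continuous_map_add continuous_map_real_max continuous_map_real_abs
        continuous_map_diff) (auto simp: cont_funs_def)
  then have "continuous_map X euclideanreal h"
    by (rule continuous_map_eq) (simp add: h_def)
  then have "h \<in> cont_funs X" by (simp add: cont_funs_def h_def)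
  moreover have hz: "\<bar>h x - z x\<bar> = max \<bar>f x - z x\<bar> \<bar>g x - z x\<bar>" if "x \<in> topspace X" for x
    using that by (simp add: h_def)
  have "h \<noteq> z"
  proof
    assume "h = z"
    then have "f x = z x" if "x \<in> topspace X" for x using hz[OF that] by auto
    then show False
      using f z extensionalityI[of f "topspace X" z] by (auto simp: cont_funs_def)
  qed
  moreover have "close_on z h u \<longleftrightarrow> close_on z f u \<and> close_on z g u"
    if "u \<in> compacts X \<times> {0<..}" for u
  proof -
    obtain K \<epsilon> where u: "u = (K, \<epsilon>)" "K \<in> compacts X"
      using \<open>u \<in> compacts X \<times> {0<..}\<close> by blast
    have "x \<in> topspace X" if "x \<in> K" for x using compacts_subset_topspace u that by blast
    then show ?thesis by (auto simp: u(1) hz)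
  qed
  ultimately show "\<exists>h\<in>cont_funs X - {z}. close_on z h t \<and>
      (\<forall>u\<in>compacts X \<times> {0<..}. close_on z h u \<longrightarrow> close_on z f u \<and> close_on z g u)"
    using t by blast
qed

section \<open>Passing between k-covers and functions\<close>

text \<open>A function \<open>f\<close> is certified by a proper open set on which it is \<open>1/(n+1)\<close>-close to \<open>z\<close>.\<close>

lemma eventual_selection_k_covers_imp_Omega_at:
  assumes "Hausdorff_space X" and nc: "\<not> compact_space X" and z: "z \<in> cont_funs X"
    and sel: "eventual_selection (proper_opens X) (compacts X) (\<lambda>U K. K \<subseteq> U)"
  shows "eventual_selection (cont_funs X - {z}) (compacts X \<times> {0<..}) (close_on z)"
proof (rule eventual_selection_transfer[OF sel,
      where R = "\<lambda>n f U. close_on z f (U, inverse (real (Suc n)))"])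
  fix A n assume A: "A \<in> test_covers (cont_funs X - {z}) (compacts X \<times> {0<..}) (close_on z)"
  let ?\<delta> = "inverse (real (Suc n))"
  have "\<exists>U\<in>{U \<in> proper_opens X. \<exists>f\<in>A. close_on z f (U, ?\<delta>)}. K \<subseteq> U" if K: "K \<in> compacts X" for K
  proof -
    obtain f where f: "f \<in> A" "close_on z f (K, ?\<delta>)"
      using A K unfolding test_covers_def by fastforce
    have fc: "f \<in> cont_funs X" using f A by (auto simp: test_covers_def)
    have KX: "K \<subseteq> topspace X" by (rule compacts_subset_topspace[OF K])
    \<comment> \<open>A point outside \<open>K\<close> is deleted, so that the open set is a proper one even if \<open>f\<close> is
      uniformly close to \<open>z\<close>.\<close>
    have "K \<noteq> topspace X" using nc K by (auto simp: compact_space_def compacts_def)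
    then obtain y where y: "y \<in> topspace X" "y \<notin> K" using KX by blast
    define U where "U = {x \<in> topspace X. \<bar>f x - z x\<bar> \<in> {..<?\<delta>}} - {y}"
    have "continuous_map X euclideanreal (\<lambda>x. \<bar>f x - z x\<bar>)"
      using fc z by (intro continuous_map_real_abs continuous_map_diff) (auto simp: cont_funs_def)
    then have "openin X {x \<in> topspace X. \<bar>f x - z x\<bar> \<in> {..<?\<delta>}}"
      by (rule openin_continuous_map_preimage) simp
    moreover have "closedin X {y}"
      using y assms(1) by (simp add: closedin_Hausdorff_singleton)
    ultimately have "openin X U" unfolding U_def by (rule openin_diff)
    moreover have KU: "K \<subseteq> U" using f y KX by (auto simp: U_def)
    ultimately have "U \<in> proper_opens X"
      using y K by (auto simp: proper_opens_def compacts_def U_def)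
    then show ?thesis using f KU by (auto simp: U_def)
  qed
  then show "{U \<in> proper_opens X. \<exists>f\<in>A. close_on z f (U, ?\<delta>)}
      \<in> test_covers (proper_opens X) (compacts X) (\<lambda>U K. K \<subseteq> U)"
    by (auto simp: test_covers_def)
next
  fix t assume "t \<in> compacts X \<times> {0::real<..}"
  then obtain K \<epsilon> where t: "t = (K, \<epsilon>)" "K \<in> compacts X" "\<epsilon> > 0" by blast
  have "\<forall>\<^sub>F n in sequentially. inverse (real (Suc n)) < \<epsilon>"
    using order_tendstoD(2)[OF LIMSEQ_inverse_real_of_nat t(3)] .
  then have "\<forall>\<^sub>F n in sequentially. \<forall>f\<in>cont_funs X - {z}. \<forall>U\<in>proper_opens X.
      close_on z f (U, inverse (real (Suc n))) \<longrightarrow> K \<subseteq> U \<longrightarrow> close_on z f t"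
    by (rule eventually_mono) (fastforce simp: t(1))
  then show "\<exists>K\<in>compacts X. \<forall>\<^sub>F n in sequentially. \<forall>f\<in>cont_funs X - {z}. \<forall>U\<in>proper_opens X.
      close_on z f (U, inverse (real (Suc n))) \<longrightarrow> K \<subseteq> U \<longrightarrow> close_on z f t"
    using t(2) by blast
qed

text \<open>An open set \<open>U\<close> is certified by a function equal to \<open>1\<close> off \<open>U\<close>: where it is smaller than \<open>1\<close>,
  in particular on a compact set where it passes the test with \<open>\<epsilon> = 1\<close>, the points lie in \<open>U\<close>.\<close>

lemma eventual_selection_Omega_at_imp_k_covers:
  assumes cr: "completely_regular_space X"
    and sel: "eventual_selection (cont_funs X - {zero_fun X}) (compacts X \<times> {0<..})
      (close_on (zero_fun X))"
  shows "eventual_selection (proper_opens X) (compacts X) (\<lambda>U K. K \<subseteq> U)"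
proof (rule eventual_selection_transfer[OF sel,
      where R = "\<lambda>_ U f. \<forall>x\<in>topspace X - U. f x = 1"])
  fix \<U> and n :: nat
  assume A: "\<U> \<in> test_covers (proper_opens X) (compacts X) (\<lambda>U K. K \<subseteq> U)"
  have "\<exists>f\<in>{f \<in> cont_funs X - {zero_fun X}. \<exists>U\<in>\<U>. \<forall>x\<in>topspace X - U. f x = 1}.
      close_on (zero_fun X) f (K, \<epsilon>)" if K: "K \<in> compacts X" "\<epsilon> > 0" for K \<epsilon>
  proof -
    obtain U where U: "U \<in> \<U>" "K \<subseteq> U" "openin X U" "U \<noteq> topspace X"
      using A K unfolding test_covers_def proper_opens_def by blast
    have KX: "K \<subseteq> topspace X" by (rule compacts_subset_topspace[OF K(1)])
    have "compactin X K" using K by (simp add: compacts_def)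
    moreover have "closedin X (topspace X - U)" using U by blast
    moreover have "disjnt K (topspace X - U)" using U by (auto simp: disjnt_def)
    ultimately obtain g where g: "continuous_map X euclideanreal g"
      "g ` (topspace X - U) \<subseteq> {1}" "g ` K \<subseteq> {0}"
      using Urysohn_completely_regular_compact_closed_alt[OF cr] by metis
    define f where "f = restrict g (topspace X)"
    have "continuous_map X euclideanreal f"
      using g(1) by (rule continuous_map_eq) (simp add: f_def)
    then have "f \<in> cont_funs X" by (simp add: cont_funs_def f_def)
    moreover have f1: "\<forall>x\<in>topspace X - U. f x = 1" using g(2) by (auto simp: f_def)
    moreover obtain y where "y \<in> topspace X - U" using U openin_subset by blast
    then have "f \<noteq> zero_fun X" using f1 by (force simp: zero_fun_def)
    moreover have "close_on (zero_fun X) f (K, \<epsilon>)"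
      using g(3) KX K(2) by (auto simp: f_def zero_fun_def)
    ultimately show ?thesis using U(1) by blast
  qed
  then show "{f \<in> cont_funs X - {zero_fun X}. \<exists>U\<in>\<U>. \<forall>x\<in>topspace X - U. f x = 1}
      \<in> test_covers (cont_funs X - {zero_fun X}) (compacts X \<times> {0<..}) (close_on (zero_fun X))"
    by (auto simp: test_covers_def)
next
  fix K assume K: "K \<in> compacts X"
  have "K \<subseteq> U" if "\<forall>x\<in>topspace X - U. f x = 1" "close_on (zero_fun X) f (K, 1)" for U f
  proof
    fix x assume x: "x \<in> K"
    then have "x \<in> topspace X" using compacts_subset_topspace[OF K] by blast
    then have "\<bar>f x\<bar> < 1" using that(2) x by (auto simp: zero_fun_def)
    then show "x \<in> U" using that(1) \<open>x \<in> topspace X\<close> by force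
  qed
  then show "\<exists>t\<in>compacts X \<times> {0<..}. \<forall>\<^sub>F n in sequentially. \<forall>U\<in>proper_opens X.
      \<forall>f\<in>cont_funs X - {zero_fun X}.
      (\<forall>x\<in>topspace X - U. f x = 1) \<longrightarrow> close_on (zero_fun X) f t \<longrightarrow> K \<subseteq> U"
    using K by (intro bexI[of _ "(K, 1)"]) auto
qed

section \<open>The equivalences\<close>

lemma Reznichenko_fan_tight_imp_S_fin:
  assumes "Reznichenko Z" "countable_fan_tightness Z" and z: "z \<in> topspace Z"
    and inf: "\<And>A. A \<in> Omega_at Z z \<Longrightarrow> infinite A"
  shows "S_fin (Omega_at Z z) (gp (Omega_at Z z))"
  unfolding S_fin_def
proof (intro allI impI)
  fix U :: "nat \<Rightarrow> 'a set" assume "\<forall>n. U n \<in> Omega_at Z z"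
  then obtain F where F: "\<forall>n. F n \<in> fin_subsets (U n)" "(\<Union>n. F n) \<in> Omega_at Z z"
    using assms(2) z unfolding countable_fan_tightness_def S_fin_def by meson
  have "countable (\<Union>n. F n)"
    using F(1) by (auto simp: fin_subsets_def intro: countable_finite)
  then have "(\<Union>n. F n) \<in> ctbl_inf_subsets (topspace Z)"
    using F(2) inf by (auto simp: ctbl_inf_subsets_def Omega_at_def)
  then show "\<exists>F. (\<forall>n. F n \<in> fin_subsets (U n)) \<and> (\<Union>n. F n) \<in> gp (Omega_at Z z)"
    using F assms(1) z unfolding Reznichenko_def by blast
qed

theorem theorem49:
  fixes X :: "'a topology"
  assumes "completely_regular_space X" and "Hausdorff_space X" and "\<not> compact_space X"
  shows "(S_fin (k_covers X) (gp (k_covers X))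
            \<longleftrightarrow> \<not> (\<exists>\<sigma>. G_fin_winning_One (k_covers X) (gp (k_covers X)) \<sigma>))
       \<and> (\<not> (\<exists>\<sigma>. G_fin_winning_One (k_covers X) (gp (k_covers X)) \<sigma>)
            \<longleftrightarrow> Reznichenko (Ck X) \<and> countable_fan_tightness (Ck X))
       \<and> (Reznichenko (Ck X) \<and> countable_fan_tightness (Ck X)
            \<longleftrightarrow> S_fin (Omega_at (Ck X) (zero_fun X)) (gp (Omega_at (Ck X) (zero_fun X))))"
proof -
  have ne: "topspace X \<noteq> {}"
    using assms(3) by (auto simp: compact_space_def)
  let ?H = "eventual_selection (proper_opens X) (compacts X) (\<lambda>U K. K \<subseteq> U)"
  let ?\<Omega> = "Omega_at (Ck X)"
  interpret k: test_family "proper_opens X" "compacts X" "\<lambda>U K. K \<subseteq> U"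
    by (rule test_family_k_covers[OF ne])
  have K: "S_fin (k_covers X) (gp (k_covers X)) \<longleftrightarrow> ?H"
    "\<not> (\<exists>\<sigma>. G_fin_winning_One (k_covers X) (gp (k_covers X)) \<sigma>) \<longleftrightarrow> ?H"
    unfolding k_covers_eq_test_covers
    by (rule k.S_fin_gp_iff_eventual_selection k.no_winning_strategy_iff_eventual_selection)+
  have \<Omega>: "S_fin (?\<Omega> z) (gp (?\<Omega> z))" "?\<Omega> z \<inter> ctbl_inf_subsets (cont_funs X) = gp (?\<Omega> z)"
    if H: ?H and z: "z \<in> cont_funs X" for z
  proof -
    interpret z: test_family "cont_funs X - {z}" "compacts X \<times> {0<..}" "close_on z"
      by (rule test_family_Omega_at[OF ne z])
    show S: "S_fin (?\<Omega> z) (gp (?\<Omega> z))"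
      unfolding Omega_at_eq_test_covers[OF ne z] z.S_fin_gp_iff_eventual_selection
      by (rule eventual_selection_k_covers_imp_Omega_at[OF assms(2,3) z H])
    show "?\<Omega> z \<inter> ctbl_inf_subsets (cont_funs X) = gp (?\<Omega> z)"
      using z.S_fin_gp_imp_countable_eq_gp S unfolding Omega_at_eq_test_covers[OF ne z] by blast
  qed
  interpret o: test_family "cont_funs X - {zero_fun X}" "compacts X \<times> {0<..}" "close_on (zero_fun X)"
    by (rule test_family_Omega_at[OF ne zero_fun_in_cont_funs])
  have "?H" if "S_fin (?\<Omega> (zero_fun X)) (gp (?\<Omega> (zero_fun X)))"
    using that unfolding Omega_at_eq_test_covers[OF ne zero_fun_in_cont_funs]
      o.S_fin_gp_iff_eventual_selection
    by (rule eventual_selection_Omega_at_imp_k_covers[OF assms(1)])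
  moreover have "Reznichenko (Ck X) \<and> countable_fan_tightness (Ck X)" if H: ?H
  proof
    show "Reznichenko (Ck X)"
      using \<Omega>(2)[OF H] by (simp add: Reznichenko_def topspace_Ck[OF ne])
    have "S_fin (?\<Omega> z) (?\<Omega> z)" if "z \<in> cont_funs X" for z
      using \<Omega>(1)[OF H that] unfolding S_fin_def gp_def by blast
    then show "countable_fan_tightness (Ck X)"
      by (simp add: countable_fan_tightness_def topspace_Ck[OF ne])
  qed
  moreover have "S_fin (?\<Omega> (zero_fun X)) (gp (?\<Omega> (zero_fun X)))"
    if "Reznichenko (Ck X)" "countable_fan_tightness (Ck X)"
    using that o.Cov_infinite
    by (intro Reznichenko_fan_tight_imp_S_fin)
      (simp_all add: topspace_Ck[OF ne] zero_fun_in_cont_funs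
        Omega_at_eq_test_covers[OF ne zero_fun_in_cont_funs])
  ultimately show ?thesis using K by blast
qed

end
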